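(* Let $(a_n)_{n \geq 1}$ be a sequence of real numbers such that $\sum_{n=1}^\infty a_n^2 = \infty$, and let $X = (X_n)_{n \ge 0}$ be the associated Rademacher random walk. Then, almost surely, $X$ is unbounded below and unbounded above, and in particular, $X$ changes sign infinitely often.
   Context: Let $\epsilon_1, \epsilon_2, \dots$ be independent Rademacher random variables, taking values $\pm 1$ each with probability $1/2$. The Rademacher random walk associated with a deterministic sequence $(a_n)_{n\ge1}$ is $X_n = \sum_{k=1}^n \epsilon_k a_k$, $n\ge0$. *)

theory Defs
  imports "HOL-Probability.Probability"
begin

definition rademacher_rv :: "'w measure \<Rightarrow> ('w \<Rightarrow> real) \<Rightarrow> bool" where
  "rademacher_rv M Y \<longleftrightarrow>
     Y \<in> borel_measurable M \<and>
     measure M {\<omega> \<in> space M. Y \<omega> = 1} = 1 / 2 \<and>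
     measure M {\<omega> \<in> space M. Y \<omega> = - 1} = 1 / 2"

text \<open>Sequences are indexed from 1; the value at index 0 is irrelevant.\<close>

definition rademacher_sequence :: "'w measure \<Rightarrow> (nat \<Rightarrow> 'w \<Rightarrow> real) \<Rightarrow> bool" where
  "rademacher_sequence M eps \<longleftrightarrow>
     prob_space M \<and>
     prob_space.indep_vars M (\<lambda>_. borel) eps {1..} \<and>
     (\<forall>n\<ge>1. rademacher_rv M (eps n))"

definition rademacher_walk ::
    "(nat \<Rightarrow> real) \<Rightarrow> (nat \<Rightarrow> 'w \<Rightarrow> real) \<Rightarrow> nat \<Rightarrow> 'w \<Rightarrow> real" where
  "rademacher_walk a eps n \<omega> = (\<Sum>k = 1..n. eps k \<omega> * a k)"

text \<open>A sign change is completed at time \<open>n\<close> if \<open>x n\<close> is nonzero and its sign is opposite to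
  that of the last nonzero value before it. Zeros in between are skipped, so the path
  \<open>1, 0, -1\<close> changes sign once, while \<open>1, 0, 1\<close> does not change sign.\<close>

definition sign_change_at :: "(nat \<Rightarrow> real) \<Rightarrow> nat \<Rightarrow> bool" where
  "sign_change_at x n \<longleftrightarrow> (\<exists>m<n. x m * x n < 0 \<and> (\<forall>k. m < k \<and> k < n \<longrightarrow> x k = 0))"

definition changes_sign_infinitely_often :: "(nat \<Rightarrow> real) \<Rightarrow> bool" where
  "changes_sign_infinitely_often x \<longleftrightarrow> infinite {n. sign_change_at x n}"

end

theory Submission
  imports Defs
begin

text \<open>
  Write \<open>s\<close> for the variance \<open>a\<^sub>1\<^sup>2 + \<dots> + a\<^sub>n\<^sup>2\<close> of \<open>X\<^sub>n\<close>. Adding the independent symmetric steps one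
  at a time shows that \<open>X\<^sub>n\<close> has vanishing first and third moments and that its fourth moment is
  at most \<open>3 s\<^sup>2\<close> (\<open>rademacher_walk_moments\<close>). Under such moment bounds a random variable exceeds
  a fixed fraction of its standard deviation with probability bounded away from zero: this is a
  one-sided form of the Paley--Zygmund inequality (\<open>one_sided_paley_zygmund\<close>). As \<open>s\<close> is
  unbounded in \<open>n\<close>, every level \<open>K\<close> is exceeded by the walk with probability at least \<open>1/32\<close>, and
  since this bound does not depend on \<open>K\<close>, the walk is unbounded above with probability at least
  \<open>1/32\<close>.

  Dropping finitely many steps moves the path by a bounded amount, so unboundedness above is a tail
  event of the independent signs, and Kolmogorov's zero-one law raises its probability to one
  (\<open>rademacher_walk_zero_one\<close>). Replacing \<open>a\<close> by \<open>-a\<close>, which preserves the hypotheses and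
  reflects the walk, gives unboundedness below. A path that is unbounded on both sides takes
  positive and negative values arbitrarily late, hence changes sign infinitely often; this last
  step involves no probability.
\<close>

section \<open>Sign changes of real sequences\<close>

text \<open>
  Beyond any index there is a positive value; the first negative value after it completes a sign
  change, because the values in between are nonnegative and the last nonzero one of them is
  positive.
\<close>

lemma infinitely_many_sign_changes:
  fixes x :: "nat \<Rightarrow> real"
  assumes below: "\<not> bdd_below (range x)" and above: "\<not> bdd_above (range x)"
  shows "changes_sign_infinitely_often x"
proof -
  have late_positive: "\<exists>p\<ge>N. y p > 0" if y: "\<not> bdd_above (range y)" for N and y :: "nat \<Rightarrow> real"
  proof (rule ccontr)
    assume "\<not> ?thesis"
    then have "y ` {N..} \<subseteq> {..0}" by force
    then have "bdd_above (y ` {N..})"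
      by (meson bdd_above_Iic bdd_above_mono)
    then have "bdd_above (y ` {..<N} \<union> y ` {N..})"
      by simp
    moreover have "{..<N} \<union> {N..} = UNIV" by auto
    ultimately show False using y by (simp flip: image_Un)
  qed
  note pos = late_positive[OF above]
  have "\<not> bdd_above (range (\<lambda>n. - x n))"
    using below bdd_above_uminus[of "range x"] by (simp add: image_image)
  from late_positive[OF this] have neg: "\<exists>q\<ge>N. x q < 0" for N by simp
  have "\<exists>n>N. sign_change_at x n" for N
  proof -
    obtain p where p: "p \<ge> N" "x p > 0" using pos by blast
    define q where "q = (LEAST q. q \<ge> p \<and> x q < 0)"
    have q: "q \<ge> p" "x q < 0"
      using LeastI_ex[of "\<lambda>q. q \<ge> p \<and> x q < 0"] neg[of p] unfolding q_def by auto
    have before_q: "x k \<ge> 0" if "p \<le> k" "k < q" for k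
      using not_less_Least[of k "\<lambda>q. q \<ge> p \<and> x q < 0"] that unfolding q_def by auto
    have "p < q" using p q by (cases "p = q") auto
    define m where "m = (GREATEST m. m < q \<and> x m \<noteq> 0)"
    have bound: "y \<le> q" if "y < q \<and> x y \<noteq> 0" for y using that by simp
    have m: "m < q" "x m \<noteq> 0"
      using GreatestI_nat[of "\<lambda>m. m < q \<and> x m \<noteq> 0" p, OF _ bound] p \<open>p < q\<close>
      unfolding m_def by auto
    have m_last: "k \<le> m" if "k < q" "x k \<noteq> 0" for k
      using Greatest_le_nat[of "\<lambda>m. m < q \<and> x m \<noteq> 0" k, OF _ bound] that
      unfolding m_def by auto
    have "p \<le> m" using m_last p \<open>p < q\<close> by simp
    then have "x m > 0" using before_q[of m] m by simp
    then have "x m * x q < 0" using q by (simp add: mult_pos_neg)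
    then have "sign_change_at x q"
      unfolding sign_change_at_def using m m_last by (intro exI[of _ m]) force
    then show ?thesis using p \<open>p < q\<close> by (intro exI[of _ q]) auto
  qed
  then show ?thesis
    unfolding changes_sign_infinitely_often_def infinite_nat_iff_unbounded by simp
qed

section \<open>Moments of the walk\<close>

lemma rademacher_walk_0 [simp]: "rademacher_walk a eps 0 \<omega> = 0"
  by (simp add: rademacher_walk_def)

lemma rademacher_walk_Suc:
  "rademacher_walk a eps (Suc n) \<omega> = rademacher_walk a eps n \<omega> + eps (Suc n) \<omega> * a (Suc n)"
  by (simp add: rademacher_walk_def)

lemma rademacher_walk_uminus:
  "rademacher_walk (\<lambda>n. - a n) eps n \<omega> = - rademacher_walk a eps n \<omega>"
  by (simp add: rademacher_walk_def sum_negf)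

lemma (in prob_space) rademacher_rv_abs:
  assumes "rademacher_rv M Y"
  shows "AE \<omega> in M. \<bar>Y \<omega>\<bar> = 1"
proof -
  have [measurable]: "Y \<in> borel_measurable M" using assms by (simp add: rademacher_rv_def)
  have "{\<omega> \<in> space M. \<bar>Y \<omega>\<bar> = 1} = {\<omega> \<in> space M. Y \<omega> = 1} \<union> {\<omega> \<in> space M. Y \<omega> = - 1}"
    by auto
  moreover have "prob ({\<omega> \<in> space M. Y \<omega> = 1} \<union> {\<omega> \<in> space M. Y \<omega> = - 1}) = 1"
    using assms by (subst finite_measure_Union) (auto simp: rademacher_rv_def)
  ultimately have "prob {\<omega> \<in> space M. \<bar>Y \<omega>\<bar> = 1} = 1" by simp
  then show ?thesis by (subst (asm) prob_Collect_eq_1) auto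
qed

lemma (in prob_space) rademacher_rv_expectation:
  assumes "rademacher_rv M Y"
  shows "integrable M Y" "expectation Y = 0"
proof -
  have [measurable]: "Y \<in> borel_measurable M" using assms by (simp add: rademacher_rv_def)
  show "integrable M Y"
    using rademacher_rv_abs[OF assms] by (intro integrable_const_bound[where B = 1]) auto
  have "expectation Y = expectation (\<lambda>\<omega>. indicat_real {\<omega> \<in> space M. Y \<omega> = 1} \<omega>
      - indicat_real {\<omega> \<in> space M. Y \<omega> = - 1} \<omega>)"
    using rademacher_rv_abs[OF assms]
    by (intro integral_cong_AE) (auto split: split_indicator simp: abs_if split: if_splits)
  also have "\<dots> = prob {\<omega> \<in> space M. Y \<omega> = 1} - prob {\<omega> \<in> space M. Y \<omega> = - 1}"
    by (subst Bochner_Integration.integral_diff) (auto simp: integrable_real_indicator emeasure_eq_measure)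
  finally show "expectation Y = 0" using assms by (simp add: rademacher_rv_def)
qed

lemma borel_measurable_rademacher_walk:
  assumes "rademacher_sequence M eps"
  shows "rademacher_walk a eps n \<in> borel_measurable M"
proof -
  have [measurable]: "eps k \<in> borel_measurable M" if "k \<in> {1..n}" for k
    using assms that by (simp add: rademacher_sequence_def rademacher_rv_def)
  show ?thesis unfolding rademacher_walk_def[abs_def] by measurable
qed

lemma integrable_rademacher_walk_power:
  assumes "rademacher_sequence M eps"
  shows "integrable M (\<lambda>\<omega>. rademacher_walk a eps n \<omega> ^ j)"
proof -
  interpret prob_space M using assms by (simp add: rademacher_sequence_def)
  note [measurable] = borel_measurable_rademacher_walk[OF assms]
  have "AE \<omega> in M. \<forall>k\<in>{1..n}. \<bar>eps k \<omega>\<bar> = 1"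
    using assms by (intro AE_finite_allI) (auto simp: rademacher_sequence_def intro: rademacher_rv_abs)
  then have "AE \<omega> in M. norm (rademacher_walk a eps n \<omega> ^ j) \<le> (\<Sum>k=1..n. \<bar>a k\<bar>) ^ j"
  proof eventually_elim
    case (elim \<omega>)
    have "\<bar>rademacher_walk a eps n \<omega>\<bar> \<le> (\<Sum>k=1..n. \<bar>eps k \<omega> * a k\<bar>)"
      unfolding rademacher_walk_def by (rule sum_abs)
    also have "\<dots> = (\<Sum>k=1..n. \<bar>a k\<bar>)" using elim by (intro sum.cong) (auto simp: abs_mult)
    finally show ?case by (simp add: power_abs power_mono)
  qed
  then show ?thesis by (intro integrable_const_bound) auto
qed

text \<open>
  The next step is centred and independent of the past. This makes every term with an odd power
  of the step disappear when moments of the walk are expanded.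
\<close>

lemma rademacher_walk_increment_orthogonal:
  assumes "rademacher_sequence M eps"
  shows "integrable M (\<lambda>\<omega>. eps (Suc n) \<omega> * a (Suc n) * rademacher_walk a eps n \<omega> ^ j)"
    and "(\<integral>\<omega>. eps (Suc n) \<omega> * a (Suc n) * rademacher_walk a eps n \<omega> ^ j \<partial>M) = 0"
proof -
  interpret prob_space M using assms by (simp add: rademacher_sequence_def)
  have ind: "indep_vars (\<lambda>_. borel) eps {1..}" and rv: "rademacher_rv M (eps (Suc n))"
    using assms by (simp_all add: rademacher_sequence_def)
  have "indep_vars (\<lambda>_. borel) (\<lambda>k \<omega>. eps k \<omega> * a k) {1..}"
    using indep_vars_compose2[OF ind, of "\<lambda>k x. x * a k" "\<lambda>_. borel"] by simp
  then have "indep_vars (\<lambda>_. borel) (\<lambda>k \<omega>. eps k \<omega> * a k) (insert (Suc n) {1..n})"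
    by (rule indep_vars_subset) auto
  then have "indep_var borel (\<lambda>\<omega>. eps (Suc n) \<omega> * a (Suc n)) borel (rademacher_walk a eps n)"
    unfolding rademacher_walk_def[abs_def] by (intro indep_vars_sum) auto
  from indep_var_compose[OF this, of "\<lambda>x. x" borel "\<lambda>x. x ^ j" borel]
  have iv: "indep_var borel (\<lambda>\<omega>. eps (Suc n) \<omega> * a (Suc n))
      borel (\<lambda>\<omega>. rademacher_walk a eps n \<omega> ^ j)"
    by (simp add: comp_def)
  have int: "integrable M (\<lambda>\<omega>. eps (Suc n) \<omega> * a (Suc n))"
    using rademacher_rv_expectation(1)[OF rv] by simp
  show "integrable M (\<lambda>\<omega>. eps (Suc n) \<omega> * a (Suc n) * rademacher_walk a eps n \<omega> ^ j)"
    by (rule indep_var_integrable[OF iv int integrable_rademacher_walk_power[OF assms]])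
  show "(\<integral>\<omega>. eps (Suc n) \<omega> * a (Suc n) * rademacher_walk a eps n \<omega> ^ j \<partial>M) = 0"
    using indep_var_lebesgue_integral[OF iv int integrable_rademacher_walk_power[OF assms]]
      rademacher_rv_expectation(2)[OF rv] by simp
qed

text \<open>
  The induction step for the third moment uses the first, and that for the fourth uses the second,
  so all four claims go through one induction on \<open>n\<close>. A step \<open>d\<close> of size \<open>c\<close> satisfies \<open>d\<^sup>2 = c\<^sup>2\<close>, so
  only its even powers survive, as constants; with \<open>s\<close> for the variance reached before this step,
  the fourth moment gains \<open>6 c\<^sup>2 s + c\<^sup>4\<close>, while
  \<open>3 s\<^sup>2\<close> gains \<open>6 c\<^sup>2 s + 3 c\<^sup>4\<close>.
\<close>

lemma rademacher_walk_moments: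
  assumes "rademacher_sequence M eps"
  shows "(\<integral>\<omega>. rademacher_walk a eps n \<omega> \<partial>M) = 0"
    and "(\<integral>\<omega>. rademacher_walk a eps n \<omega> ^ 2 \<partial>M) = (\<Sum>k=1..n. (a k)\<^sup>2)"
    and "(\<integral>\<omega>. rademacher_walk a eps n \<omega> ^ 3 \<partial>M) = 0"
    and "(\<integral>\<omega>. rademacher_walk a eps n \<omega> ^ 4 \<partial>M) \<le> 3 * (\<Sum>k=1..n. (a k)\<^sup>2)\<^sup>2"
proof -
  interpret prob_space M using assms by (simp add: rademacher_sequence_def)
  let ?X = "rademacher_walk a eps" and ?s = "\<lambda>n. \<Sum>k=1..n. (a k)\<^sup>2"
  have "expectation (?X n) = 0 \<and> expectation (\<lambda>\<omega>. ?X n \<omega> ^ 2) = ?s n \<and>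
      expectation (\<lambda>\<omega>. ?X n \<omega> ^ 3) = 0 \<and> expectation (\<lambda>\<omega>. ?X n \<omega> ^ 4) \<le> 3 * (?s n)\<^sup>2"
  proof (induction n)
    case 0
    then show ?case by simp
  next
    case (Suc n)
    define D where "D = (\<lambda>\<omega>. eps (Suc n) \<omega> * a (Suc n))"
    let ?c = "a (Suc n)"
    note X = integrable_rademacher_walk_power[OF assms, of a n]
    have DX: "integrable M (\<lambda>\<omega>. D \<omega> * ?X n \<omega> ^ j)" "expectation (\<lambda>\<omega>. D \<omega> * ?X n \<omega> ^ j) = 0" for j
      using rademacher_walk_increment_orthogonal[OF assms, of n a j] by (simp_all add: D_def)
    note [measurable] = borel_measurable_rademacher_walk[OF assms]
    have [measurable]: "eps (Suc n) \<in> borel_measurable M"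
      using assms by (simp add: rademacher_sequence_def rademacher_rv_def)
    have [measurable]: "D \<in> borel_measurable M" unfolding D_def by measurable
    have step: "?X (Suc n) \<omega> = ?X n \<omega> + D \<omega>" for \<omega>
      by (simp add: rademacher_walk_Suc D_def)
    have "AE \<omega> in M. \<bar>eps (Suc n) \<omega>\<bar> = 1"
      using assms by (intro rademacher_rv_abs) (simp add: rademacher_sequence_def)
    then have sq: "AE \<omega> in M. D \<omega> ^ 2 = ?c\<^sup>2"
      by eventually_elim (simp add: D_def power_mult_distrib flip: power2_abs[of "eps _ _"])
    have m1: "expectation (\<lambda>\<omega>. ?X (Suc n) \<omega>) = expectation (?X n)"
      unfolding step using X[of 1] DX[of 0] by simp
    have "expectation (\<lambda>\<omega>. ?X (Suc n) \<omega> ^ 2)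
        = expectation (\<lambda>\<omega>. ?X n \<omega> ^ 2 + 2 * (D \<omega> * ?X n \<omega> ^ 1) + ?c\<^sup>2)"
      unfolding step
      by (intro integral_cong_AE; (measurable; fail)?)
         (use sq in eventually_elim, simp add: power2_eq_square algebra_simps)
    also have "\<dots> = expectation (\<lambda>\<omega>. ?X n \<omega> ^ 2) + ?c\<^sup>2"
      using X[of 2] DX[of 1] by (simp add: prob_space)
    finally have m2: "expectation (\<lambda>\<omega>. ?X (Suc n) \<omega> ^ 2) = expectation (\<lambda>\<omega>. ?X n \<omega> ^ 2) + ?c\<^sup>2" .
    have cube: "(x + d) ^ 3 = x ^ 3 + 3 * (d * x ^ 2) + 3 * c\<^sup>2 * x + c\<^sup>2 * d" if "d\<^sup>2 = c\<^sup>2"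
      for x d c :: real
      unfolding that[symmetric] by algebra
    have fourth: "(x + d) ^ 4 = x ^ 4 + 4 * (d * x ^ 3) + 6 * c\<^sup>2 * x ^ 2 + 4 * c\<^sup>2 * (d * x) + c ^ 4"
      if "d\<^sup>2 = c\<^sup>2" for x d c :: real
    proof -
      have "c ^ 4 = (c\<^sup>2)\<^sup>2" by simp
      then show ?thesis unfolding that[symmetric] by algebra
    qed
    have "expectation (\<lambda>\<omega>. ?X (Suc n) \<omega> ^ 3)
        = expectation (\<lambda>\<omega>. ?X n \<omega> ^ 3 + 3 * (D \<omega> * ?X n \<omega> ^ 2) + 3 * ?c\<^sup>2 * ?X n \<omega> + ?c\<^sup>2 * D \<omega>)"
      unfolding step
      by (intro integral_cong_AE; (measurable; fail)?)
         (use sq in eventually_elim, simp add: cube)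
    also have "\<dots> = expectation (\<lambda>\<omega>. ?X n \<omega> ^ 3) + 3 * ?c\<^sup>2 * expectation (?X n)"
      using X[of 3] X[of 1] DX[of 2] DX[of 0] by simp
    finally have m3: "expectation (\<lambda>\<omega>. ?X (Suc n) \<omega> ^ 3)
        = expectation (\<lambda>\<omega>. ?X n \<omega> ^ 3) + 3 * ?c\<^sup>2 * expectation (?X n)" .
    have "expectation (\<lambda>\<omega>. ?X (Suc n) \<omega> ^ 4)
        = expectation (\<lambda>\<omega>. ?X n \<omega> ^ 4 + 4 * (D \<omega> * ?X n \<omega> ^ 3) + 6 * ?c\<^sup>2 * ?X n \<omega> ^ 2
            + 4 * ?c\<^sup>2 * (D \<omega> * ?X n \<omega>) + ?c ^ 4)"
      unfolding step
      by (intro integral_cong_AE; (measurable; fail)?)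
         (use sq in eventually_elim, simp add: fourth)
    also have "\<dots> = expectation (\<lambda>\<omega>. ?X n \<omega> ^ 4) + 6 * ?c\<^sup>2 * expectation (\<lambda>\<omega>. ?X n \<omega> ^ 2) + ?c ^ 4"
      using X[of 4] X[of 2] DX[of 3] DX[of 1] by (simp add: prob_space)
    finally have m4: "expectation (\<lambda>\<omega>. ?X (Suc n) \<omega> ^ 4)
        = expectation (\<lambda>\<omega>. ?X n \<omega> ^ 4) + 6 * ?c\<^sup>2 * expectation (\<lambda>\<omega>. ?X n \<omega> ^ 2) + ?c ^ 4" .
    have "3 * s\<^sup>2 + 6 * c\<^sup>2 * s + c ^ 4 \<le> 3 * (s + c\<^sup>2)\<^sup>2" for s c :: real
    proof -
      have "3 * (s + c\<^sup>2)\<^sup>2 = 3 * s\<^sup>2 + 6 * c\<^sup>2 * s + c ^ 4 + 2 * (c\<^sup>2)\<^sup>2"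
        by (simp add: algebra_simps power2_eq_square power4_eq_xxxx)
      then show ?thesis by simp
    qed
    from this[of "?s n" ?c] show ?case using Suc.IH by (simp add: m1 m2 m3 m4)
  qed
  then show "expectation (?X n) = 0" "expectation (\<lambda>\<omega>. ?X n \<omega> ^ 2) = ?s n"
    "expectation (\<lambda>\<omega>. ?X n \<omega> ^ 3) = 0" "expectation (\<lambda>\<omega>. ?X n \<omega> ^ 4) \<le> 3 * (?s n)\<^sup>2"
    by auto
qed

section \<open>Exceeding high levels with positive probability\<close>

text \<open>
  The reason is the quartic \<open>q x = x (2 \<sigma> - x) (x + 2 \<sigma>)\<^sup>2\<close>, which is positive only on the interval
  \<open>(0, 2 \<sigma>)\<close>. Its expectation is \<open>4 \<sigma>\<^sup>4\<close> minus the fourth moment, hence at least \<open>\<sigma>\<^sup>4\<close>. On the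
  other hand \<open>q\<close> never exceeds \<open>16 \<sigma>\<^sup>4\<close>, and it is at most \<open>\<sigma>\<^sup>4 / 2\<close> up to \<open>\<sigma> / 64\<close>. So at least half
  of the expectation has to come from values above \<open>\<sigma> / 64\<close>. The vanishing third moment
  is what makes the cubic term of \<open>q\<close> harmless.
\<close>

lemma (in prob_space) one_sided_paley_zygmund:
  fixes X :: "'a \<Rightarrow> real"
  assumes int: "integrable M X" "integrable M (\<lambda>\<omega>. X \<omega> ^ 2)"
      "integrable M (\<lambda>\<omega>. X \<omega> ^ 3)" "integrable M (\<lambda>\<omega>. X \<omega> ^ 4)"
    and moments: "expectation X = 0" "expectation (\<lambda>\<omega>. X \<omega> ^ 2) = \<sigma>\<^sup>2"
      "expectation (\<lambda>\<omega>. X \<omega> ^ 3) = 0" "expectation (\<lambda>\<omega>. X \<omega> ^ 4) \<le> 3 * \<sigma> ^ 4"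
    and \<sigma>: "\<sigma> > 0"
  shows "prob {\<omega> \<in> space M. X \<omega> > \<sigma> / 64} \<ge> 1 / 32"
proof -
  define q where "q = (\<lambda>x. x * (2 * \<sigma> - x) * (x + 2 * \<sigma>)\<^sup>2)"
  let ?A = "{\<omega> \<in> space M. X \<omega> > \<sigma> / 64}"
  have [measurable]: "X \<in> borel_measurable M" using int by auto
  have "?A \<in> events" by measurable
  then have ind_int: "integrable M (\<lambda>\<omega>. 16 * \<sigma> ^ 4 * indicator ?A \<omega> :: real)"
    by (intro integrable_mult_right integrable_real_indicator) (auto simp: emeasure_eq_measure)
  have q_eq: "q x = 8 * \<sigma> ^ 3 * x + 4 * \<sigma>\<^sup>2 * x ^ 2 - 2 * \<sigma> * x ^ 3 - x ^ 4" for x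
    unfolding q_def by algebra
  have q_int: "integrable M (\<lambda>\<omega>. q (X \<omega>))" unfolding q_eq using int by simp
  have "\<sigma> ^ 4 \<le> 4 * \<sigma>\<^sup>2 * \<sigma>\<^sup>2 - expectation (\<lambda>\<omega>. X \<omega> ^ 4)"
    using moments(4) by (simp add: power4_eq_xxxx power2_eq_square)
  also have "\<dots> = expectation (\<lambda>\<omega>. q (X \<omega>))"
    unfolding q_eq using int moments by simp
  also have "\<dots> \<le> expectation (\<lambda>\<omega>. \<sigma> ^ 4 / 2 + 16 * \<sigma> ^ 4 * indicator ?A \<omega>)"
  proof (rule integral_mono[OF q_int])
    fix \<omega> assume \<omega>: "\<omega> \<in> space M"
    show "q (X \<omega>) \<le> \<sigma> ^ 4 / 2 + 16 * \<sigma> ^ 4 * indicator ?A \<omega>"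
    proof (cases "0 < X \<omega> \<and> X \<omega> < 2 * \<sigma>")
      case False
      then have "X \<omega> * (2 * \<sigma> - X \<omega>) \<le> 0" using \<sigma>
        by (auto simp: not_less mult_nonneg_nonpos mult_nonpos_nonneg)
      then have "q (X \<omega>) \<le> 0" unfolding q_def by (simp add: mult_nonpos_nonneg)
      then show ?thesis using \<sigma> by (smt (verit) indicator_pos_le mult_nonneg_nonneg zero_le_power divide_nonneg_pos)
    next
      case True
      have sq: "(X \<omega> + 2 * \<sigma>)\<^sup>2 \<le> (4 * \<sigma>)\<^sup>2" using True by (intro power_mono) auto
      show ?thesis
      proof (cases "X \<omega> > \<sigma> / 64")
        case big: True
        have "\<sigma>\<^sup>2 - X \<omega> * (2 * \<sigma> - X \<omega>) = (\<sigma> - X \<omega>)\<^sup>2"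
          by (simp add: power2_eq_square algebra_simps)
        then have "X \<omega> * (2 * \<sigma> - X \<omega>) \<le> \<sigma>\<^sup>2"
          by (smt (verit) zero_le_power2)
        then have "q (X \<omega>) \<le> \<sigma>\<^sup>2 * (4 * \<sigma>)\<^sup>2"
          unfolding q_def using sq by (intro mult_mono) auto
        also have "\<dots> = 16 * \<sigma> ^ 4" by (simp add: power2_eq_square power4_eq_xxxx)
        also have "\<dots> \<le> \<sigma> ^ 4 / 2 + 16 * \<sigma> ^ 4" using \<sigma> by simp
        finally show ?thesis using big \<omega> by simp
      next
        case False
        then have "q (X \<omega>) \<le> (\<sigma> / 64 * (2 * \<sigma>)) * (4 * \<sigma>)\<^sup>2"
          unfolding q_def using sq True by (intro mult_mono) auto
        also have "\<dots> = \<sigma> ^ 4 / 2" by (simp add: power2_eq_square power4_eq_xxxx)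
        finally show ?thesis using False by simp
      qed
    qed
  qed (use ind_int in simp)
  also have "\<dots> = \<sigma> ^ 4 / 2 + 16 * \<sigma> ^ 4 * prob ?A"
    using ind_int by (subst Bochner_Integration.integral_add) (auto simp: prob_space)
  finally have "\<sigma> ^ 4 * (1 / 2) \<le> \<sigma> ^ 4 * (16 * prob ?A)" by simp
  then show ?thesis using \<sigma> by (simp add: mult_le_cancel_left)
qed

lemma rademacher_walk_exceeds:
  assumes rs: "rademacher_sequence M eps"
    and div: "(\<Sum>n. ennreal ((a (Suc n))\<^sup>2)) = \<infinity>"
  shows "measure M {\<omega> \<in> space M. \<exists>n. rademacher_walk a eps n \<omega> > K} \<ge> 1 / 32"
proof -
  interpret prob_space M using rs by (simp add: rademacher_sequence_def)
  note [measurable] = borel_measurable_rademacher_walk[OF rs]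
  \<comment> \<open>One 64th of any standard deviation above this value exceeds the level \<open>K\<close>;
    the maximum keeps it positive when \<open>K\<close> is not.\<close>
  define \<sigma> where "\<sigma> = 64 * max 1 K"
  have "\<exists>n. (\<Sum>k=1..n. (a k)\<^sup>2) > \<sigma>\<^sup>2"
  proof (rule ccontr)
    assume "\<not> ?thesis"
    then have bound: "(\<Sum>k=1..n. (a k)\<^sup>2) \<le> \<sigma>\<^sup>2" for n by (simp add: not_less)
    have "(\<Sum>n. ennreal ((a (Suc n))\<^sup>2)) = (SUP n. \<Sum>k<n. ennreal ((a (Suc k))\<^sup>2))"
      by (rule suminf_eq_SUP)
    also have "\<dots> \<le> ennreal (\<sigma>\<^sup>2)"
    proof (rule SUP_least)
      fix n
      have "(\<Sum>k<n. (a (Suc k))\<^sup>2) = (\<Sum>k=1..n. (a k)\<^sup>2)"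
        by (simp add: sum.atLeast1_atMost_eq)
      then show "(\<Sum>k<n. ennreal ((a (Suc k))\<^sup>2)) \<le> ennreal (\<sigma>\<^sup>2)"
        using bound[of n] by (simp add: sum_ennreal)
    qed
    finally show False using div by (simp add: top_unique)
  qed
  then obtain n where n: "(\<Sum>k=1..n. (a k)\<^sup>2) > \<sigma>\<^sup>2" by blast
  define \<tau> where "\<tau> = sqrt (\<Sum>k=1..n. (a k)\<^sup>2)"
  have "\<tau> > \<sigma>" unfolding \<tau>_def using n by (simp add: real_less_rsqrt)
  then have \<tau>: "\<tau> > 0" "\<tau> / 64 > K" by (auto simp: \<sigma>_def)
  have \<tau>2: "\<tau>\<^sup>2 = (\<Sum>k=1..n. (a k)\<^sup>2)" by (simp add: \<tau>_def sum_nonneg)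
  have \<tau>4: "\<tau> ^ 4 = (\<Sum>k=1..n. (a k)\<^sup>2)\<^sup>2"
    unfolding \<tau>2[symmetric] by simp
  have "1 / 32 \<le> prob {\<omega> \<in> space M. rademacher_walk a eps n \<omega> > \<tau> / 64}"
    using integrable_rademacher_walk_power[OF rs, of a n]
      integrable_rademacher_walk_power[OF rs, of a n 1]
      rademacher_walk_moments[OF rs, of a n] \<tau>
    by (intro one_sided_paley_zygmund) (simp_all add: \<tau>2 \<tau>4)
  also have "\<dots> \<le> prob {\<omega> \<in> space M. \<exists>n. rademacher_walk a eps n \<omega> > K}"
    using \<tau> by (intro finite_measure_mono) (auto intro: less_trans exI[of _ n])
  finally show ?thesis .
qed

section \<open>Unboundedness by the zero-one law\<close>

text \<open>
  Countably many levels suffice, which makes unboundedness a measurable event.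
\<close>

lemma not_bdd_above_range_iff:
  fixes x :: "nat \<Rightarrow> real"
  shows "\<not> bdd_above (range x) \<longleftrightarrow> (\<forall>K::nat. \<exists>n. x n > K)"
proof
  assume "\<not> bdd_above (range x)"
  then show "\<forall>K::nat. \<exists>n. x n > K" by (auto simp: bdd_above_def not_le)
next
  assume *: "\<forall>K::nat. \<exists>n. x n > K"
  show "\<not> bdd_above (range x)"
  proof
    assume "bdd_above (range x)"
    then obtain B where "x n \<le> B" for n by (auto simp: bdd_above_def)
    then show False using * real_arch_simple[of B] by (meson less_le_not_le order_trans)
  qed
qed

text \<open>
  For every \<open>N\<close> the event depends only on the steps after time \<open>N\<close>, because the path differs from
  the sum of those steps by at most the largest absolute value reached up to time \<open>N\<close>.
\<close>

lemma rademacher_walk_zero_one: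
  fixes a :: "nat \<Rightarrow> real"
  assumes rs: "rademacher_sequence M eps"
  defines "E \<equiv> {\<omega> \<in> space M. \<not> bdd_above (range (\<lambda>n. rademacher_walk a eps n \<omega>))}"
  shows "measure M E = 0 \<or> measure M E = 1"
proof -
  interpret prob_space M using rs by (simp add: rademacher_sequence_def)
  \<comment> \<open>Signs are indexed from 1, while the zero-one law is about families indexed from 0.\<close>
  define F where "F = (\<lambda>i. {eps (Suc i) -` A \<inter> space M | A. A \<in> sets borel})"
  have ind: "indep_vars (\<lambda>_. borel) eps {1..}" using rs by (simp add: rademacher_sequence_def)
  have F: "indep_sets F UNIV"
    unfolding indep_sets_def
  proof (intro conjI ballI allI impI)
    have indep: "indep_sets (\<lambda>i. {eps i -` A \<inter> space M | A. A \<in> sets borel}) {1..}"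
      using ind unfolding indep_vars_def2 by blast
    fix i
    show "F i \<subseteq> events"
      using indep unfolding indep_sets_def F_def by auto
    fix J :: "nat set" and A
    assume J: "J \<subseteq> UNIV" "J \<noteq> {}" "finite J" and A: "A \<in> Pi J F"
    have "prob (\<Inter>j\<in>Suc ` J. A (j - 1)) = (\<Prod>j\<in>Suc ` J. prob (A (j - 1)))"
      using J A by (intro indep_setsD[OF indep]) (auto simp: F_def)
    then show "prob (\<Inter>j\<in>J. A j) = (\<Prod>j\<in>J. prob (A j))"
      by (simp add: prod.reindex)
  qed
  have F_alg: "sigma_algebra (space M) (F i)" for i
  proof -
    have "F i = sets (vimage_algebra (space M) (eps (Suc i)) borel)"
      unfolding F_def by (rule sets_vimage_algebra2[symmetric]) auto
    then show ?thesis
      by (metis sets.sigma_algebra_axioms space_vimage_algebra)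
  qed
  have "E \<in> sigma_sets (space M) (\<Union>i\<in>{N..}. F i)" for N
  proof -
    define G where "G = sigma (space M) (\<Union>i\<in>{N..}. F i)"
    have sp: "space G = space M" by (simp add: G_def space_measure_of_conv)
    have sub: "(\<Union>i\<in>{N..}. F i) \<subseteq> Pow (space M)" by (auto simp: F_def)
    have sets_G: "sets G = sigma_sets (space M) (\<Union>i\<in>{N..}. F i)"
      unfolding G_def by (rule sets_measure_of[OF sub])
    have eps_G: "eps k \<in> borel_measurable G" if "k > N" for k
    proof (rule measurableI)
      fix A :: "real set" assume "A \<in> sets borel"
      then have "eps k -` A \<inter> space M \<in> F (k - 1)" using that by (auto simp: F_def)
      then show "eps k -` A \<inter> space G \<in> sets G"
        using that unfolding sets_G sp by (intro sigma_sets.Basic) auto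
    qed auto
    define T where "T = (\<lambda>n \<omega>. \<Sum>k\<in>{N<..n}. eps k \<omega> * a k)"
    have [measurable]: "T n \<in> borel_measurable G" for n
      unfolding T_def by (intro borel_measurable_sum borel_measurable_times eps_G) auto
    have "\<not> bdd_above (range (\<lambda>n. rademacher_walk a eps n \<omega>)) \<longleftrightarrow>
        \<not> bdd_above (range (\<lambda>n. T n \<omega>))" for \<omega>
    proof -
      define C where "C = Max ((\<lambda>k. \<bar>rademacher_walk a eps k \<omega>\<bar>) ` {..N})"
      have split: "rademacher_walk a eps n \<omega> = rademacher_walk a eps (min n N) \<omega> + T n \<omega>" for n
      proof (cases "n \<le> N")
        case False
        then have "{1..n} = {1..N} \<union> {N<..n}" by auto
        then show ?thesis using False
          unfolding rademacher_walk_def T_def by (simp add: sum.union_disjoint ivl_disj_int)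
      qed (simp add: T_def)
      have "\<bar>rademacher_walk a eps (min n N) \<omega>\<bar> \<le> C" for n
        unfolding C_def by (intro Max_ge) auto
      then have close: "\<bar>rademacher_walk a eps n \<omega> - T n \<omega>\<bar> \<le> C" for n
        using split[of n] by simp
      have "bdd_above (range y)" if bdd: "bdd_above (range x)" and dist: "\<And>n. \<bar>x n - y n\<bar> \<le> C"
        for x y :: "nat \<Rightarrow> real"
      proof -
        obtain B where "\<forall>v\<in>range x. v \<le> B" using bdd unfolding bdd_above_def by blast
        then have B: "x n \<le> B" for n by simp
        have "y n \<le> B + C" for n using B[of n] dist[of n] by linarith
        then show ?thesis by (auto simp: bdd_above_def)
      qed
      then show ?thesis using close by (metis abs_minus_commute)
    qed
    then have "E = {\<omega> \<in> space G. \<forall>K::nat. \<exists>n. T n \<omega> > K}"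
      unfolding E_def sp not_bdd_above_range_iff by simp
    also have "\<dots> \<in> sets G" by measurable
    finally show ?thesis unfolding sets_G .
  qed
  then have "E \<in> tail_events F" unfolding tail_events_def by auto
  from kolmogorov_0_1_law[OF F_alg F this] show ?thesis .
qed

text \<open>
  The events of exceeding the levels \<open>K\<close> decrease to unboundedness above, so the uniform lower
  bound \<open>1/32\<close> passes to the limit and excludes the value zero.
\<close>

lemma rademacher_walk_unbounded_above:
  assumes rs: "rademacher_sequence M eps"
    and div: "(\<Sum>n. ennreal ((a (Suc n))\<^sup>2)) = \<infinity>"
  shows "AE \<omega> in M. \<not> bdd_above (range (\<lambda>n. rademacher_walk a eps n \<omega>))"
proof -
  interpret prob_space M using rs by (simp add: rademacher_sequence_def)
  note [measurable] = borel_measurable_rademacher_walk[OF rs]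
  let ?X = "rademacher_walk a eps"
  let ?B = "\<lambda>K::nat. {\<omega> \<in> space M. \<exists>n. ?X n \<omega> > K}"
  let ?E = "{\<omega> \<in> space M. \<not> bdd_above (range (\<lambda>n. ?X n \<omega>))}"
  have "(\<lambda>K. prob (?B K)) \<longlonglongrightarrow> prob (\<Inter>K. ?B K)"
  proof (rule finite_Lim_measure_decseq)
    show "decseq ?B"
      unfolding decseq_def
    proof (intro allI impI subsetI)
      fix K L :: nat and \<omega> assume "K \<le> L" "\<omega> \<in> ?B L"
      then show "\<omega> \<in> ?B K" by (force intro: le_less_trans[of "real K" "real L"])
    qed
  qed auto
  then have "1 / 32 \<le> prob (\<Inter>K. ?B K)"
    by (rule LIMSEQ_le_const) (use rademacher_walk_exceeds[OF rs div] in blast)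
  also have "(\<Inter>K. ?B K) = ?E" by (auto simp: not_bdd_above_range_iff)
  finally have "prob ?E = 1" using rademacher_walk_zero_one[OF rs, of a] by auto
  moreover have "?E \<in> sets M"
    unfolding not_bdd_above_range_iff by measurable
  ultimately show ?thesis by (simp add: prob_Collect_eq_1)
qed

theorem lemma10:
  fixes M :: "'w measure" and eps :: "nat \<Rightarrow> 'w \<Rightarrow> real" and a :: "nat \<Rightarrow> real"
  assumes "rademacher_sequence M eps"
    and "(\<Sum>n. ennreal ((a (Suc n))\<^sup>2)) = \<infinity>"
  shows "AE \<omega> in M.
           \<not> bdd_below (range (\<lambda>n. rademacher_walk a eps n \<omega>)) \<and>
           \<not> bdd_above (range (\<lambda>n. rademacher_walk a eps n \<omega>)) \<and>
           changes_sign_infinitely_often (\<lambda>n. rademacher_walk a eps n \<omega>)"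
proof -
  have "AE \<omega> in M. \<not> bdd_above (range (\<lambda>n. rademacher_walk a eps n \<omega>))"
    using assms by (rule rademacher_walk_unbounded_above)
  moreover have "AE \<omega> in M. \<not> bdd_above (range (\<lambda>n. rademacher_walk (\<lambda>k. - a k) eps n \<omega>))"
    using assms by (intro rademacher_walk_unbounded_above) auto
  ultimately show ?thesis
  proof eventually_elim
    case (elim \<omega>)
    have "\<not> bdd_below (range (\<lambda>n. rademacher_walk a eps n \<omega>))"
    proof
      assume "bdd_below (range (\<lambda>n. rademacher_walk a eps n \<omega>))"
      then have "bdd_above (uminus ` range (\<lambda>n. rademacher_walk a eps n \<omega>))"
        by (rule bdd_above_uminus[THEN iffD2])
      then show False using elim(2) by (simp add: rademacher_walk_uminus image_image)
    qed
    then show ?case using elim(1) by (intro conjI infinitely_many_sign_changes)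
  qed
qed

end
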